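(* Let $G$ be a connected undirected weighted graph on the vertices $\{1,\ldots,n\}$ with symmetric nonnegative adjacency matrix $A=(a_{ij})$, $n\ge 2$, and let $1\le p<q\le n$. Let $D$, $P$, $S$, $\bm w_{pq}$, $\kappa$ be as in the context, let $P_{pq}(t)=P+t\,a_{pq}D^{-1}\bm w_{pq}\bm w_{pq}^\top$, and set $$\alpha(p,q)=\bm w_{pq}^\top S^{-1}\bm w_{pq},\qquad \beta(p,q)=\bm w_{pq}^\top S^{-1}DS^{-1}\bm w_{pq}.$$ Then for every $t\in[0,1]$ with $1-t\,a_{pq}\,\alpha(p,q)\neq 0$, $$\kappa(P_{pq}(t))=\kappa(P)+\frac{t\,a_{pq}}{1-t\,a_{pq}\,\alpha(p,q)}\,\beta(p,q),$$ and, for every integer $i\ge 1$, the $i$-th derivative of $t\mapsto\kappa(P_{pq}(t))$ at such a $t$ (one-sided at the endpoints of $[0,1]$) is $$\frac{d^i}{dt^i}\,\kappa(P_{pq}(t))=\frac{i!\,(a_{pq})^i}{(1-t\,a_{pq}\,\alpha(p,q))^{i+1}}\,\alpha(p,q)^{i-1}\beta(p,q).$$ In particular, $\frac{d}{dt}\kappa(P_{pq}(t))\big|_{t=0}=a_{pq}\,\beta(p,q)$.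
   Context: $G$ is a connected undirected weighted graph on $\{1,\ldots,n\}$ (loops allowed) with symmetric adjacency matrix $A=(a_{ij})$: $a_{ij}=a_{ji}>0$ is the weight of the edge $\{i,j\}$ if it exists, and $a_{ij}=0$ otherwise. Let $\bm 1$ be the all-ones vector, $\bm e_i$ the $i$-th standard basis vector, $\bm d=A\bm 1=(d_i)$ (all $d_i>0$ by connectedness), $D=\mathrm{diag}(\bm d)$, $P=D^{-1}A$ (an irreducible stochastic matrix), $S=D-A+\frac{1}{\|\bm d\|_1}\bm d\bm d^\top$ (which is symmetric positive definite), and $\bm w_{pq}=\bm e_p-\bm e_q$. Kemeny's constant: for a real $n\times n$ matrix $Q$ with $Q\bm 1=\bm 1$, put $\kappa(Q)=\mathrm{trace}\big((I-Q+\bm 1\bm v^\top)^{-1}\big)-1$, where $\bm v\in\mathbb R^n$ is any vector with $\bm v^\top\bm 1=1$; it is defined whenever the inverse exists and does not depend on $\bm v$. For the matrices considered here one may take $\bm v=\bm d/\|\bm d\|_1$. The matrix $P_{pq}(t)=D^{-1}(A+t\,a_{pq}\bm w_{pq}\bm w_{pq}^\top)$ is the transition matrix of the graph obtained from $G$ by changing the weight $a_{pq}$ of $\{p,q\}$ to $(1-t)a_{pq}$ and adding weight $t\,a_{pq}$ to the loops at $p$ and $q$. Convention: $\alpha(p,q)^0=1$. *)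

theory Defs
  imports "HOL-Analysis.Analysis"
begin

definition connected_weighted_graph :: "real^'n^'n \<Rightarrow> bool" where
  "connected_weighted_graph A \<longleftrightarrow>
     transpose A = A \<and> (\<forall>i j. A $ i $ j \<ge> 0) \<and>
     (\<forall>i j. (i, j) \<in> {(k, l). A $ k $ l > 0}\<^sup>*)"

definition outer :: "real^'n \<Rightarrow> real^'n \<Rightarrow> real^'n^'n" where
  "outer u v = (\<chi> i j. u $ i * v $ j)"

definition diag :: "real^'n \<Rightarrow> real^'n^'n" where
  "diag v = (\<chi> i j. if i = j then v $ i else 0)"

definition deg :: "real^'n^'n \<Rightarrow> real^'n" where
  "deg A = A *v 1"

(* The library norm on real^'n is Euclidean, hence a separate 1-norm. *)
definition norm1 :: "real^'n \<Rightarrow> real" where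
  "norm1 v = (\<Sum>i\<in>UNIV. \<bar>v $ i\<bar>)"

definition D_mat :: "real^'n^'n \<Rightarrow> real^'n^'n" where
  "D_mat A = diag (deg A)"

definition P_mat :: "real^'n^'n \<Rightarrow> real^'n^'n" where
  "P_mat A = matrix_inv (D_mat A) ** A"

definition S_mat :: "real^'n^'n \<Rightarrow> real^'n^'n" where
  "S_mat A = D_mat A - A + (1 / norm1 (deg A)) *\<^sub>R outer (deg A) (deg A)"

definition w_vec :: "'n \<Rightarrow> 'n \<Rightarrow> real^'n" where
  "w_vec p q = axis p 1 - axis q 1"

definition P_pert :: "real^'n^'n \<Rightarrow> 'n \<Rightarrow> 'n \<Rightarrow> real \<Rightarrow> real^'n^'n" where
  "P_pert A p q t =
     P_mat A + (t * A $ p $ q) *\<^sub>R (matrix_inv (D_mat A) ** outer (w_vec p q) (w_vec p q))"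

definition alpha :: "real^'n^'n \<Rightarrow> 'n \<Rightarrow> 'n \<Rightarrow> real" where
  "alpha A p q = w_vec p q \<bullet> (matrix_inv (S_mat A) *v w_vec p q)"

definition beta :: "real^'n^'n \<Rightarrow> 'n \<Rightarrow> 'n \<Rightarrow> real" where
  "beta A p q =
     w_vec p q \<bullet> ((matrix_inv (S_mat A) ** D_mat A ** matrix_inv (S_mat A)) *v w_vec p q)"

definition kemeny_defined :: "real^'n^'n \<Rightarrow> bool" where
  "kemeny_defined Q \<longleftrightarrow>
     Q *v 1 = 1 \<and> (\<exists>v. v \<bullet> 1 = 1 \<and> invertible (mat 1 - Q + outer 1 v))"

definition kemeny :: "real^'n^'n \<Rightarrow> real" where
  "kemeny Q = (THE k. \<exists>v. v \<bullet> 1 = 1 \<and> invertible (mat 1 - Q + outer 1 v) \<and>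
     k = trace (matrix_inv (mat 1 - Q + outer 1 v)) - 1)"

(* Where kemeny_defined Q holds, the description in kemeny denotes: the trace
   does not depend on v. *)
lemma kemeny_eq:
  fixes Q :: "real^'n^'n"
  assumes Q: "Q *v 1 = 1" and v: "v \<bullet> 1 = 1"
    and inv: "invertible (mat 1 - Q + outer 1 v)"
  shows "kemeny Q = trace (matrix_inv (mat 1 - Q + outer 1 v)) - 1"
proof -
  have one: "(mat 1 - Q + outer 1 u) *v 1 = 1" if "u \<bullet> 1 = 1" for u :: "real^'n"
  proof -
    have "outer 1 u *v 1 = (1 :: real^'n)"
      using that by (simp add: outer_def matrix_vector_mult_def inner_vec_def vec_eq_iff)
    then show ?thesis
      using Q by (simp add: matrix_vector_mult_add_rdistrib matrix_vector_mult_diff_rdistrib)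
  qed
  have eq: "trace (matrix_inv (mat 1 - Q + outer 1 u)) = trace (matrix_inv (mat 1 - Q + outer 1 v))"
    if u: "u \<bullet> 1 = 1" and iu: "invertible (mat 1 - Q + outer 1 u)" for u :: "real^'n"
  proof -
    define M where "M = mat 1 - Q + outer 1 u"
    define N where "N = mat 1 - Q + outer 1 v"
    define E where "E = outer 1 (u - v)"
    have ME: "M = N + E"
      by (simp add: M_def N_def E_def outer_def vec_eq_iff algebra_simps)
    have minv: "B ** matrix_inv B = mat 1 \<and> matrix_inv B ** B = mat 1"
      if "invertible B" for B :: "real^'n^'n"
      using that unfolding invertible_def matrix_inv_def by (rule someI_ex)
    have NI: "N ** matrix_inv N = mat 1" "matrix_inv N ** N = mat 1"
      using inv minv by (auto simp: N_def)
    have MI: "M ** matrix_inv M = mat 1" "matrix_inv M ** M = mat 1"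
      using iu minv by (auto simp: M_def)
    have N1: "matrix_inv N *v 1 = 1"
      using one[OF v] NI(2) by (metis N_def matrix_vector_mul_assoc matrix_vector_mul_lid)
    have M1: "matrix_inv M *v 1 = 1"
      using one[OF u] MI(2) by (metis M_def matrix_vector_mul_assoc matrix_vector_mul_lid)
    have outer_left: "B ** outer x y = outer (B *v x) y" for B and x y :: "real^'n"
      by (simp add: outer_def matrix_matrix_mult_def matrix_vector_mult_def vec_eq_iff
          sum_distrib_right mult.assoc)
    have distr: "(X + Y) ** Z = X ** Z + Y ** Z" for X Y Z :: "real^'n^'n"
      by (simp add: matrix_matrix_mult_def vec_eq_iff distrib_right sum.distrib)
    have ME': "matrix_inv M ** E = E"
      by (simp add: E_def outer_left M1)
    have "matrix_inv M ** (M ** matrix_inv N) = matrix_inv M ** (mat 1 + E ** matrix_inv N)"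
      unfolding NI(1)[symmetric] distr[symmetric] ME ..
    also have "\<dots> = matrix_inv M + E ** matrix_inv N"
      by (simp add: matrix_add_ldistrib matrix_mul_assoc ME')
    finally have "matrix_inv N = matrix_inv M + E ** matrix_inv N"
      unfolding matrix_mul_assoc MI matrix_mul_lid .
    then have "trace (matrix_inv N) = trace (matrix_inv M) + trace (matrix_inv N ** E)"
      unfolding trace_mul_sym[of "matrix_inv N" E] trace_add[symmetric] by (rule arg_cong)
    moreover have "matrix_inv N ** E = E"
      by (simp add: E_def outer_left N1)
    moreover have "trace E = (u - v) \<bullet> 1"
      by (simp add: E_def trace_def outer_def inner_vec_def)
    ultimately show ?thesis
      using u v by (simp add: M_def N_def inner_diff_left)
  qed
  show ?thesis
    unfolding kemeny_def
  proof (rule the_equality)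
    show "\<exists>u. u \<bullet> 1 = 1 \<and> invertible (mat 1 - Q + outer 1 u) \<and>
        trace (matrix_inv (mat 1 - Q + outer 1 v)) - 1 = trace (matrix_inv (mat 1 - Q + outer 1 u)) - 1"
      using v inv by blast
  next
    fix k
    assume "\<exists>u. u \<bullet> 1 = 1 \<and> invertible (mat 1 - Q + outer 1 u) \<and>
        k = trace (matrix_inv (mat 1 - Q + outer 1 u)) - 1"
    then obtain u where u: "u \<bullet> 1 = 1" "invertible (mat 1 - Q + outer 1 u)"
      and k: "k = trace (matrix_inv (mat 1 - Q + outer 1 u)) - 1"
      by blast
    show "k = trace (matrix_inv (mat 1 - Q + outer 1 v)) - 1"
      unfolding k eq[OF u] ..
  qed
qed

(* g is the i-th derivative of f on T. Derivatives are relative to T: two-sided at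
   interior points of T, one-sided at endpoints of intervals. If no point of T is isolated,
   g is determined on T by f, i and T. *)
primrec has_nth_derivative_on ::
  "(real \<Rightarrow> real) \<Rightarrow> nat \<Rightarrow> (real \<Rightarrow> real) \<Rightarrow> real set \<Rightarrow> bool" where
  "has_nth_derivative_on f 0 g T \<longleftrightarrow> (\<forall>t\<in>T. g t = f t)"
| "has_nth_derivative_on f (Suc i) g T \<longleftrightarrow>
     (\<exists>h. has_nth_derivative_on f i h T \<and>
          (\<forall>t\<in>T. (h has_real_derivative g t) (at t within T)))"

end

(* Up to the factor D^{-1} on the left, I - P + 1 v^T with v = d / ||d||_1 is S, and the perturbation
   subtracts t a_pq w w^T from S. The Sherman-Morrison formula inverts this rank-one update, and
   cyclicity of the trace turns the correction term into beta. In t this is a Moebius function, whose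
   derivatives are explicit. *)
theory Submission
  imports Defs
begin

section \<open>Inverses and rank-one matrices\<close>

lemma matrix_inv_invertible:
  assumes "invertible M"
  shows "M ** matrix_inv M = mat 1" "matrix_inv M ** M = mat 1"
  using someI_ex[OF assms[unfolded invertible_def]] by (auto simp: matrix_inv_def)

text \<open>A one-sided inverse of a square matrix over a field is two-sided, so exhibiting a right
  inverse identifies \<open>matrix_inv\<close>.\<close>

lemma right_inverse_matrix:
  fixes M N :: "'a::field^'n^'n"
  assumes "M ** N = mat 1"
  shows "invertible M" "matrix_inv M = N"
proof -
  have "N ** M = mat 1"
    using assms by (simp add: matrix_left_right_inverse)
  with assms show "invertible M"
    unfolding invertible_def by blast
  then show "matrix_inv M = N"
    by (metis \<open>N ** M = mat 1\<close> matrix_inv_invertible(1) matrix_mul_assoc matrix_mul_lid matrix_mul_rid)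
qed

lemma matrix_matrix_add_rdistrib:
  fixes X Y :: "'a::semiring_1^'n^'m"
  shows "(X + Y) ** Z = X ** Z + Y ** Z"
  by (simp add: matrix_matrix_mult_def vec_eq_iff distrib_right sum.distrib)

lemma matrix_diff_rdistrib:
  fixes X Y :: "'a::ring_1^'n^'m"
  shows "(X - Y) ** Z = X ** Z - Y ** Z"
  by (simp add: matrix_matrix_mult_def vec_eq_iff left_diff_distrib sum_subtractf)

lemma matrix_diff_ldistrib:
  fixes Y Z :: "'a::ring_1^'n^'m"
  shows "X ** (Y - Z) = X ** Y - X ** Z"
  by (simp add: matrix_matrix_mult_def vec_eq_iff right_diff_distrib sum_subtractf)

lemma matrix_mult_outer: "M ** outer x y = outer (M *v x) y"
  by (simp add: outer_def matrix_matrix_mult_def matrix_vector_mult_def vec_eq_iff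
      sum_distrib_right mult.assoc)

lemma outer_mult_matrix: "outer x y ** M = outer x (y v* M)"
  by (simp add: outer_def matrix_matrix_mult_def vector_matrix_mult_def vec_eq_iff
      sum_distrib_left mult.assoc mult.left_commute)

lemma outer_mult_vector: "outer x y *v z = (y \<bullet> z) *\<^sub>R x"
  by (simp add: outer_def matrix_vector_mult_def inner_vec_def vec_eq_iff
      sum_distrib_left sum_distrib_right mult_ac)

lemma outer_scaleR_left: "outer (c *\<^sub>R x) y = c *\<^sub>R outer x y"
  by (simp add: outer_def vec_eq_iff)

lemma outer_scaleR_right: "outer x (c *\<^sub>R y) = c *\<^sub>R outer x y"
  by (simp add: outer_def vec_eq_iff)

lemma outer_mult_outer: "outer x y ** outer u v = (y \<bullet> u) *\<^sub>R outer x v"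
  by (simp add: matrix_mult_outer outer_mult_vector outer_scaleR_left)

lemma trace_outer: "trace (outer x y) = x \<bullet> y"
  by (simp add: trace_def outer_def inner_vec_def)

lemma trace_scaleR: "trace (c *\<^sub>R M) = c * trace (M :: real^'n^'n)"
  by (simp add: trace_def sum_distrib_left)

text \<open>With s = y . Nx and k the coefficient of the correction, the product expands to I + (k -
  c - c k s) x y^T N. The value k = c / (1 - c s) is the solution of k - c k s = c.\<close>

lemma Sherman_Morrison:
  fixes M N :: "real^'n^'n" and x y :: "real^'n"
  assumes "M ** N = mat 1" and "1 - c * (y \<bullet> (N *v x)) \<noteq> 0"
  shows "(M - c *\<^sub>R outer x y) **
    (N + (c / (1 - c * (y \<bullet> (N *v x)))) *\<^sub>R (N ** outer x y ** N)) = mat 1"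
proof -
  define k where "k = c / (1 - c * (y \<bullet> (N *v x)))"
  have "M ** (N ** outer x y ** N) = outer x y ** N"
    using assms(1) by (simp add: matrix_mul_assoc)
  moreover have "outer x y ** (N ** outer x y ** N) = (y \<bullet> (N *v x)) *\<^sub>R (outer x y ** N)"
    by (simp add: matrix_mul_assoc matrix_mult_outer outer_mult_vector outer_scaleR_left
        scalar_matrix_assoc matrix_vector_mul_assoc[symmetric])
  moreover have "k * (1 - c * (y \<bullet> (N *v x))) = c"
    using assms(2) by (simp add: k_def)
  then have "k - c * (k * (y \<bullet> (N *v x))) = c"
    by (simp add: algebra_simps)
  then have "k *\<^sub>R (outer x y ** N) - (c * (k * (y \<bullet> (N *v x)))) *\<^sub>R (outer x y ** N)
      = c *\<^sub>R (outer x y ** N)"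
    by (metis scaleR_diff_left)
  ultimately have "(M - c *\<^sub>R outer x y) ** (N + k *\<^sub>R (N ** outer x y ** N)) = mat 1"
    using assms(1)
    by (simp add: matrix_diff_rdistrib matrix_add_ldistrib matrix_scalar_ac
        scalar_matrix_assoc[symmetric] algebra_simps)
  then show ?thesis
    by (simp add: k_def)
qed

lemma diag_mult_vector: "(diag v *v x) $ i = v $ i * x $ i"
  by (simp add: diag_def matrix_vector_mult_def if_distrib[where f = "\<lambda>z. z * _"] cong: if_cong)

lemma invertible_iff_ker:
  fixes M :: "'a::field^'n^'n"
  shows "invertible M \<longleftrightarrow> (\<forall>x. M *v x = 0 \<longrightarrow> x = 0)"
  by (simp add: invertible_left_inverse matrix_left_invertible_ker)

section \<open>The matrix S of a connected graph\<close>

lemma deg_nth: "deg A $ i = (\<Sum>j\<in>UNIV. A $ i $ j)"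
  by (simp add: deg_def matrix_vector_mult_def)

text \<open>A second vertex makes the path leaving i nonempty, and its first edge contributes to the
  degree. On one vertex the zero matrix is connected, as reachability is reflexive, but has degree
  0.\<close>

lemma connected_deg_pos:
  fixes A :: "real^'n^'n"
  assumes "connected_weighted_graph A" and "CARD('n) \<ge> 2"
  shows "deg A $ i > 0"
proof -
  obtain j where "j \<noteq> i"
    using assms(2) by (metis (full_types) card_le_Suc0_iff_eq finite
        not_less_eq_eq numeral_2_eq_2)
  moreover have "(i, j) \<in> {(k, l). A $ k $ l > 0}\<^sup>*"
    using assms(1) by (simp add: connected_weighted_graph_def)
  ultimately obtain k where "A $ i $ k > 0"
    by (auto elim: converse_rtranclE)
  moreover have "A $ i $ k \<le> (\<Sum>j\<in>UNIV. A $ i $ j)"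
    using assms(1) by (intro member_le_sum) (auto simp: connected_weighted_graph_def)
  ultimately show ?thesis
    by (simp add: deg_nth)
qed

lemma norm1_deg:
  assumes "\<And>i. deg A $ i > 0"
  shows "norm1 (deg A) = deg A \<bullet> 1" "norm1 (deg A) > 0"
proof -
  show *: "norm1 (deg A) = deg A \<bullet> 1"
    using assms by (simp add: norm1_def inner_vec_def abs_of_pos)
  show "norm1 (deg A) > 0"
    unfolding norm1_def using assms by (intro sum_pos) (auto simp: abs_of_pos)
qed

text \<open>The Dirichlet energy of the graph. The sum runs over ordered pairs and counts each edge
  between distinct vertices twice, whence the factor 2; loops contribute 0.\<close>

lemma laplacian_quadratic_form:
  fixes A :: "real^'n^'n"
  assumes "transpose A = A"
  shows "2 * (x \<bullet> ((D_mat A - A) *v x)) = (\<Sum>i\<in>UNIV. \<Sum>j\<in>UNIV. A $ i $ j * (x $ i - x $ j)\<^sup>2)"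
proof -
  have sym: "A $ j $ i = A $ i $ j" for i j
    using assms by (simp add: vec_eq_iff transpose_def)
  have "(\<Sum>i\<in>UNIV. \<Sum>j\<in>UNIV. A $ i $ j * (x $ i)\<^sup>2)
      = (\<Sum>i\<in>UNIV. \<Sum>j\<in>UNIV. A $ i $ j * (x $ j)\<^sup>2)"
    by (subst sum.swap) (simp add: sym)
  moreover have "x \<bullet> ((D_mat A - A) *v x)
      = (\<Sum>i\<in>UNIV. \<Sum>j\<in>UNIV. A $ i $ j * (x $ i)\<^sup>2) - (\<Sum>i\<in>UNIV. \<Sum>j\<in>UNIV. A $ i $ j * x $ i * x $ j)"
    by (simp add: inner_vec_def D_mat_def matrix_vector_mult_diff_rdistrib diag_mult_vector deg_nth
        right_diff_distrib sum_subtractf)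
      (simp add: matrix_vector_mult_def sum_distrib_left sum_distrib_right power2_eq_square mult_ac)
  moreover have "(\<Sum>i\<in>UNIV. \<Sum>j\<in>UNIV. A $ i $ j * (x $ i - x $ j)\<^sup>2)
      = (\<Sum>i\<in>UNIV. \<Sum>j\<in>UNIV. A $ i $ j * (x $ i)\<^sup>2) + (\<Sum>i\<in>UNIV. \<Sum>j\<in>UNIV. A $ i $ j * (x $ j)\<^sup>2)
        - 2 * (\<Sum>i\<in>UNIV. \<Sum>j\<in>UNIV. A $ i $ j * x $ i * x $ j)"
    by (simp add: power2_diff sum_distrib_left sum.distrib[symmetric] sum_subtractf[symmetric]
        algebra_simps)
  ultimately show ?thesis
    by simp
qed

text \<open>If S x = 0, then x . Sx = 0 splits into the Dirichlet energy and (d . x)^2 / ||d||_1,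
  both nonnegative, so both vanish. Zero energy makes x constant along edges, hence constant by
  connectedness; d . x = 0 then forces that constant to be 0, since d . 1 > 0.\<close>

lemma invertible_S_mat:
  fixes A :: "real^'n^'n"
  assumes conn: "connected_weighted_graph A" and pos: "\<And>i. deg A $ i > 0"
  shows "invertible (S_mat A)"
proof -
  have "x = 0" if "S_mat A *v x = 0" for x
  proof -
    let ?m = "norm1 (deg A)"
    let ?E = "\<Sum>i\<in>UNIV. \<Sum>j\<in>UNIV. A $ i $ j * (x $ i - x $ j)\<^sup>2"
    note m = norm1_deg[OF pos]
    have nonneg: "A $ i $ j \<ge> 0" for i j
      using conn by (simp add: connected_weighted_graph_def)
    have "x \<bullet> (S_mat A *v x) = x \<bullet> ((D_mat A - A) *v x) + (deg A \<bullet> x)\<^sup>2 / ?m"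
      by (simp add: S_mat_def matrix_vector_mult_add_rdistrib scaleR_matrix_vector_assoc[symmetric]
          outer_mult_vector inner_add_right power2_eq_square inner_commute)
    then have "?E + 2 * ((deg A \<bullet> x)\<^sup>2 / ?m) = 0"
      using that conn laplacian_quadratic_form[of A x] by (simp add: connected_weighted_graph_def)
    moreover have "?E \<ge> 0"
      by (intro sum_nonneg mult_nonneg_nonneg nonneg) auto
    moreover have "(deg A \<bullet> x)\<^sup>2 / ?m \<ge> 0"
      using m(2) by simp
    ultimately have E: "?E = 0" and "(deg A \<bullet> x)\<^sup>2 / ?m = 0"
      by linarith+
    then have dx: "deg A \<bullet> x = 0"
      using m(2) by simp
    have "A $ i $ j * (x $ i - x $ j)\<^sup>2 = 0" for i j
      using E nonneg by (simp add: sum_nonneg_eq_0_iff sum_nonneg)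
    then have edge: "x $ i = x $ j" if "A $ i $ j > 0" for i j
      using that by (metis less_irrefl mult_eq_0_iff power_eq_0_iff eq_iff_diff_eq_0)
    have const: "x $ i = x $ j" for i j
    proof -
      have "(i, j) \<in> {(k, l). A $ k $ l > 0}\<^sup>*"
        using conn by (simp add: connected_weighted_graph_def)
      then show ?thesis
        by induction (auto dest: edge)
    qed
    have "x = x $ i *\<^sub>R 1" for i
      using const[of _ i] by (subst vec_eq_iff)
        (metis mult.right_neutral one_index real_scaleR_def
          vector_scaleR_component)
    then have "x $ i * ?m = 0" for i
      using dx m(1) by (metis inner_scaleR_right)
    then show ?thesis
      using m(2) by (simp add: vec_eq_iff)
  qed
  then show ?thesis
    by (simp add: invertible_iff_ker)
qed

section \<open>Kemeny's constant of the perturbed walk\<close>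

text \<open>Leaving c free covers both walks: c = 0 gives P and c = t a_pq gives the perturbed
  matrix. Orthogonality of y to 1 keeps the row sums equal to 1.\<close>

lemma kemeny_rank_one_update:
  fixes A :: "real^'n^'n" and x y :: "real^'n"
  defines "N \<equiv> matrix_inv (S_mat A)"
  assumes conn: "connected_weighted_graph A" and pos: "\<And>i. deg A $ i > 0"
    and y: "y \<bullet> 1 = 0"
    and nz: "1 - c * (y \<bullet> (N *v x)) \<noteq> 0"
    and Q: "Q = P_mat A + c *\<^sub>R (matrix_inv (D_mat A) ** outer x y)"
  shows "kemeny_defined Q"
    and "kemeny Q = trace (N ** D_mat A) - 1
      + c / (1 - c * (y \<bullet> (N *v x))) * (y \<bullet> ((N ** D_mat A ** N) *v x))"
proof -
  let ?D = "D_mat A" and ?m = "norm1 (deg A)"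
  let ?k = "c / (1 - c * (y \<bullet> (N *v x)))"
  define Di where "Di = matrix_inv ?D"
  define v where "v = (1 / ?m) *\<^sub>R deg A"
  define R where "R = N + ?k *\<^sub>R (N ** outer x y ** N)"
  note m = norm1_deg[OF pos]
  have "invertible ?D"
    using pos by (auto simp: invertible_iff_ker D_mat_def vec_eq_iff diag_mult_vector)
      (metis less_irrefl)
  then have Di: "?D ** Di = mat 1" "Di ** ?D = mat 1"
    by (simp_all add: Di_def matrix_inv_invertible)
  have D1: "?D *v 1 = deg A"
    by (simp add: vec_eq_iff D_mat_def diag_mult_vector)
  have Did: "Di *v deg A = 1"
    by (metis D1 Di(2) matrix_vector_mul_assoc matrix_vector_mul_lid)
  have v: "v \<bullet> 1 = 1"
    using m by (simp add: v_def)
  have "Di ** outer (deg A) (deg A) = ?m *\<^sub>R outer 1 v"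
    using m(2) by (simp add: matrix_mult_outer Did v_def outer_scaleR_right)
  then have factored: "mat 1 - Q + outer 1 v = Di ** (S_mat A - c *\<^sub>R outer x y)"
    using m(2)
    by (simp add: Q P_mat_def S_mat_def Di_def[symmetric] matrix_diff_ldistrib matrix_add_ldistrib
        matrix_scalar_ac scalar_matrix_assoc[symmetric] Di algebra_simps)
  \<comment> \<open>Since D^{-1} stands on the left in \<open>factored\<close>, the inverse carries
    D on the right: it is \<open>R ** ?D\<close>.\<close>
  have "(S_mat A - c *\<^sub>R outer x y) ** R = mat 1"
    unfolding R_def
    by (rule Sherman_Morrison[OF _ nz])
      (simp add: N_def matrix_inv_invertible invertible_S_mat[OF conn pos])
  then have "(mat 1 - Q + outer 1 v) ** (R ** ?D) = mat 1"
    unfolding factored by (metis Di(2) matrix_mul_assoc matrix_mul_lid)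
  note inv = right_inverse_matrix[OF this]
  have "Q *v 1 = Di *v (A *v 1) + c *\<^sub>R (Di *v (outer x y *v 1))"
    by (simp add: Q P_mat_def Di_def[symmetric] matrix_vector_mult_add_rdistrib
        scaleR_matrix_vector_assoc[symmetric] matrix_vector_mul_assoc)
  then have Q1: "Q *v 1 = 1"
    using Did by (simp add: deg_def outer_mult_vector y)
  show "kemeny_defined Q"
    using Q1 v inv(1) by (auto simp: kemeny_defined_def)
  \<comment> \<open>Cyclic rotation gathers N D N to the left of x y^T, leaving the trace of the
    rank-one matrix (N D N x) y^T, which is an inner product.\<close>
  have "trace (N ** outer x y ** N ** ?D) = trace (outer x y ** (N ** ?D ** N))"
    by (metis matrix_mul_assoc trace_mul_sym)
  also have "\<dots> = trace ((N ** ?D ** N) ** outer x y)"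
    by (rule trace_mul_sym)
  also have "\<dots> = y \<bullet> ((N ** ?D ** N) *v x)"
    by (simp add: matrix_mult_outer trace_outer inner_commute)
  finally have "trace (R ** ?D) = trace (N ** ?D) + ?k * (y \<bullet> ((N ** ?D ** N) *v x))"
    by (simp add: R_def matrix_matrix_add_rdistrib trace_add scalar_matrix_assoc[symmetric] trace_scaleR)
  then show "kemeny Q = trace (N ** ?D) - 1 + ?k * (y \<bullet> ((N ** ?D ** N) *v x))"
    using kemeny_eq[OF Q1 v inv(1)] inv(2) by simp
qed

lemma kemeny_P_pert:
  fixes A :: "real^('n::finite)^'n"
  assumes "connected_weighted_graph A" and pos: "\<And>i. deg A $ i > 0"
    and nz: "1 - t * A $ p $ q * alpha A p q \<noteq> 0"
  shows "kemeny_defined (P_mat A)" and "kemeny_defined (P_pert A p q t)"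
    and "kemeny (P_pert A p q t) =
      kemeny (P_mat A) + t * A $ p $ q / (1 - t * A $ p $ q * alpha A p q) * beta A p q"
proof -
  have w: "w_vec p q \<bullet> (1 :: real^'n) = 0"
    by (simp add: w_vec_def inner_diff_left inner_axis')
  note update = kemeny_rank_one_update[OF assms(1) pos w]
  \<comment> \<open>The case c = 0 of the update: the condition on the denominator becomes 1
    \<noteq> 0, and \<open>kemeny (P_mat A)\<close> comes out as trace (S^{-1} D) - 1, the constant
    term of the perturbed formula.\<close>
  have "P_mat A = P_mat A + 0 *\<^sub>R (matrix_inv (D_mat A) ** outer (w_vec p q) (w_vec p q))"
    by simp
  note unperturbed = update[OF _ this, simplified]
  note perturbed = update[OF nz[unfolded alpha_def] P_pert_def]
  show "kemeny_defined (P_mat A)" "kemeny_defined (P_pert A p q t)"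
    using unperturbed(1) perturbed(1) by simp_all
  show "kemeny (P_pert A p q t) =
      kemeny (P_mat A) + t * A $ p $ q / (1 - t * A $ p $ q * alpha A p q) * beta A p q"
    unfolding unperturbed(2) perturbed(2) by (simp add: alpha_def beta_def)
qed

section \<open>Derivatives of a Moebius function\<close>

text \<open>In the quotient rule the numerator a (1 - t a \<alpha>) + t a (a \<alpha>) collapses to
  a.\<close>

lemma has_derivative_moebius:
  fixes a b k \<alpha> t :: real
  assumes "1 - t * a * \<alpha> \<noteq> 0"
  shows "((\<lambda>t. k + t * a / (1 - t * a * \<alpha>) * b) has_real_derivative a * b / (1 - t * a * \<alpha>)\<^sup>2)
    (at t within T)"
  using assms by (auto intro!: derivative_eq_intros simp: field_simps power2_eq_square)

text \<open>Induction starts at order 1: the first differentiation removes both k and the t in the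
  numerator. What remains is a multiple of 1 / (1 - t a \<alpha>)^(i + 1), and each further
  differentiation contributes the factor (i + 1) a \<alpha> / (1 - t a \<alpha>).\<close>

lemma has_nth_derivative_on_moebius:
  fixes a b k \<alpha> :: real
  assumes f: "\<And>t. t \<in> T \<Longrightarrow> f t = k + t * a / (1 - t * a * \<alpha>) * b"
    and nz: "\<And>t. t \<in> T \<Longrightarrow> 1 - t * a * \<alpha> \<noteq> 0"
    and "i \<ge> 1"
  shows "has_nth_derivative_on f i
    (\<lambda>t. fact i * a ^ i / (1 - t * a * \<alpha>) ^ (i + 1) * \<alpha> ^ (i - 1) * b) T"
  using \<open>i \<ge> 1\<close>
proof (induction i rule: dec_induct)
  case base
  \<comment> \<open>The order-0 witness is the closed formula in place of f: agreement on T
    suffices, so nothing about f outside T enters.\<close>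
  have "has_nth_derivative_on f 0 (\<lambda>t. k + t * a / (1 - t * a * \<alpha>) * b) T"
    using f by simp
  moreover have "((\<lambda>t. k + t * a / (1 - t * a * \<alpha>) * b) has_real_derivative
      fact 1 * a ^ 1 / (1 - t * a * \<alpha>) ^ (1 + 1) * \<alpha> ^ (1 - 1) * b) (at t within T)"
    if "t \<in> T" for t
    using has_derivative_moebius[OF nz[OF that], of k b T] by (simp add: power2_eq_square)
  ultimately show ?case
    unfolding One_nat_def has_nth_derivative_on.simps(2) by blast
next
  case (step i)
  \<comment> \<open>The exponent \<open>i - 1\<close> is a truncated subtraction; with i a
    successor, \<alpha> * \<alpha>^(i - 1) is \<alpha>^i.\<close>
  then obtain j where i: "i = Suc j"
    by (cases i) auto
  have "((\<lambda>t. fact i * a ^ i / (1 - t * a * \<alpha>) ^ (i + 1) * \<alpha> ^ (i - 1) * b) has_real_derivative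
      fact (Suc i) * a ^ Suc i / (1 - t * a * \<alpha>) ^ (Suc i + 1) * \<alpha> ^ (Suc i - 1) * b) (at t within T)"
    if "t \<in> T" for t
  proof -
    define u where "u = 1 - t * a * \<alpha>"
    have "u \<noteq> 0"
      using nz[OF that] by (simp add: u_def)
    have "((\<lambda>t. 1 - t * a * \<alpha>) has_real_derivative - (a * \<alpha>)) (at t within T)"
      by (auto intro!: derivative_eq_intros)
    from DERIV_power[OF this, of "i + 1"]
    have pow: "((\<lambda>t. (1 - t * a * \<alpha>) ^ (i + 1)) has_real_derivative
        real (i + 1) * (- (a * \<alpha>) * u ^ i)) (at t within T)"
      by (simp add: u_def)
    have "((\<lambda>t. inverse ((1 - t * a * \<alpha>) ^ (i + 1))) has_real_derivative
        - (inverse (u ^ (i + 1)) * (real (i + 1) * (- (a * \<alpha>) * u ^ i)) * inverse (u ^ (i + 1))))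
        (at t within T)"
      using DERIV_inverse'[OF pow] \<open>u \<noteq> 0\<close> by (simp add: u_def)
    \<comment> \<open>The two signs cancel, and u^i / u^(2 i + 2) leaves 1 / u^(i + 2).\<close>
    also have "- (inverse (u ^ (i + 1)) * (real (i + 1) * (- (a * \<alpha>) * u ^ i)) * inverse (u ^ (i + 1)))
        = real (i + 1) * a * \<alpha> / u ^ (i + 2)"
      using \<open>u \<noteq> 0\<close> by (simp add: field_simps)
    finally have "((\<lambda>t. inverse ((1 - t * a * \<alpha>) ^ (i + 1))) has_real_derivative
        real (i + 1) * a * \<alpha> / u ^ (i + 2)) (at t within T)" .
    from DERIV_cmult[OF this, of "fact i * a ^ i * \<alpha> ^ (i - 1) * b"]
    show ?thesis
      \<comment> \<open>Taking the identity for \<open>P\<close> leaves an equation between the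
        derivative statement just obtained and the goal; the factor i + 1 turns
        \<open>fact i\<close> into \<open>fact (Suc i)\<close>.\<close>
      by (rule back_subst[where P = "\<lambda>x. x"])
        (simp add: i u_def divide_inverse mult_ac)
  qed
  with step.IH show ?case
    by (auto simp del: fact_Suc power_Suc)
qed

theorem theorem1:
  fixes A :: "real^('n::{finite,linorder})^('n::{finite,linorder})" and p q :: 'n
  assumes "CARD('n) \<ge> 2"
    and "connected_weighted_graph A"
    and "p < q"
  shows "(\<forall>t\<in>{0..1}. 1 - t * A $ p $ q * alpha A p q \<noteq> 0 \<longrightarrow>
            kemeny_defined (P_mat A) \<and> kemeny_defined (P_pert A p q t) \<and>
            kemeny (P_pert A p q t) =
              kemeny (P_mat A)
              + t * A $ p $ q / (1 - t * A $ p $ q * alpha A p q) * beta A p q)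
       \<and> (\<forall>i\<ge>1. has_nth_derivative_on (\<lambda>t. kemeny (P_pert A p q t)) i
            (\<lambda>t. fact i * (A $ p $ q) ^ i / (1 - t * A $ p $ q * alpha A p q) ^ (i + 1)
                 * alpha A p q ^ (i - 1) * beta A p q)
            {t \<in> {0..1}. 1 - t * A $ p $ q * alpha A p q \<noteq> 0})
       \<and> ((\<lambda>t. kemeny (P_pert A p q t)) has_real_derivative A $ p $ q * beta A p q)
            (at 0 within {0..1})"
proof (intro conjI ballI allI impI)
  let ?a = "A $ p $ q" and ?T = "{t \<in> {0..1}. 1 - t * A $ p $ q * alpha A p q \<noteq> 0}"
  note pos = connected_deg_pos[OF assms(2,1)]
  note formula = kemeny_P_pert[OF assms(2) pos]
  show "kemeny_defined (P_mat A)" "kemeny_defined (P_pert A p q t)"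
    "kemeny (P_pert A p q t) =
      kemeny (P_mat A) + t * ?a / (1 - t * ?a * alpha A p q) * beta A p q"
    if "1 - t * ?a * alpha A p q \<noteq> 0" for t
    using formula[OF that] .
  show "has_nth_derivative_on (\<lambda>t. kemeny (P_pert A p q t)) i
      (\<lambda>t. fact i * ?a ^ i / (1 - t * ?a * alpha A p q) ^ (i + 1) * alpha A p q ^ (i - 1) * beta A p q) ?T"
    if "i \<ge> 1" for i
    by (rule has_nth_derivative_on_moebius[OF _ _ that]) (auto simp: formula(3))
  \<comment> \<open>This derivative is relative to all of [0,1], which may contain a zero of the
    denominator. The denominator is 1 at t = 0 and its nonvanishing is an open condition, so the
    closed formula holds near 0 and can be differentiated there.\<close>
  have "((\<lambda>t. kemeny (P_mat A) + t * ?a / (1 - t * ?a * alpha A p q) * beta A p q)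
      has_real_derivative ?a * beta A p q) (at 0 within {0..1})"
    using has_derivative_moebius[of 0 ?a "alpha A p q"] by simp
  moreover have "open {t. 1 - t * ?a * alpha A p q \<noteq> 0}"
    by (intro open_Collect_neq continuous_intros)
  then have "eventually (\<lambda>t. 1 - t * ?a * alpha A p q \<noteq> 0) (at 0 within {0..1})"
    by (auto simp: eventually_at_topological)
  then have "eventually (\<lambda>t. kemeny (P_pert A p q t) =
      kemeny (P_mat A) + t * ?a / (1 - t * ?a * alpha A p q) * beta A p q) (at 0 within {0..1})"
    by (rule eventually_mono) (rule formula(3))
  ultimately show "((\<lambda>t. kemeny (P_pert A p q t)) has_real_derivative ?a * beta A p q)
      (at 0 within {0..1})"
    using formula(3)[of 0 p q] by (subst has_field_derivative_cong_eventually) auto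
qed

end
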